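(* For every $k\ge1$, the property of graphs of having cochromatic number at most $k$ admits a size-oblivious one-sided error tester with query complexity $$\widetilde O\!\left(\frac{k^7}{\varepsilon^6}\right).$$
   Context: A graph is a finite simple labelled graph. The cochromatic number $z(G)$ is the least $k$ for which $V(G)$ can be partitioned into $k$ parts (empty parts allowed), each inducing either an independent set or a clique. Distance: for graphs $G,G'$ on the same $n$-element vertex set, $\mathrm{dist}(G,G')=|E(G)\triangle E(G')|/n^2$; $G$ is $\varepsilon$-far from a graph property $\Pi$ if the minimum of $\mathrm{dist}(G,G')$ over $G'\in\Pi$ with $V(G')=V(G)$ exceeds $\varepsilon$. A size-oblivious tester for $\Pi$ is a randomized oracle algorithm which, given $\varepsilon>0$ but not $|V(G)|$, has oracle access to the adjacency predicate of $G$ and to independent uniform samples from $V(G)$ (a request for a sample larger than the input being interpreted as a request to inspect the whole graph), accepts every $G\in\Pi$ with probability at least $2/3$, and rejects every $G$ that is $\varepsilon$-far from $\Pi$ with probability at least $2/3$. Its query complexity is the maximum number of adjacency queries and its sample complexity the maximum number of vertex labels inspected; both must be bounded in terms of $\varepsilon$ only. It has one-sided error if it accepts every graph in $\Pi$ with probability one. $\widetilde O(\cdot)$ hides polylogarithmic factors in the displayed quantities. *)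

theory Defs
  imports "HOL-Probability.Probability"
begin

section \<open>Graphs and the cochromatic number\<close>

text \<open>
  Vertex sets are arbitrary finite sets of natural numbers, not initial segments, so that a
  vertex label carries no information about the number of vertices.
\<close>

record graph =
  verts :: "nat set"
  edges :: "nat set set"

definition simple_graph :: "graph \<Rightarrow> bool" where
  "simple_graph G \<longleftrightarrow> finite (verts G) \<and> (\<forall>e\<in>edges G. e \<subseteq> verts G \<and> card e = 2)"

definition adjacent :: "graph \<Rightarrow> nat \<Rightarrow> nat \<Rightarrow> bool" where
  "adjacent G u v \<longleftrightarrow> {u, v} \<in> edges G"

definition independent_in :: "graph \<Rightarrow> nat set \<Rightarrow> bool" where
  "independent_in G S \<longleftrightarrow> S \<subseteq> verts G \<and> (\<forall>u\<in>S. \<forall>v\<in>S. u \<noteq> v \<longrightarrow> \<not> adjacent G u v)"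

definition clique_in :: "graph \<Rightarrow> nat set \<Rightarrow> bool" where
  "clique_in G S \<longleftrightarrow> S \<subseteq> verts G \<and> (\<forall>u\<in>S. \<forall>v\<in>S. u \<noteq> v \<longrightarrow> adjacent G u v)"

definition cocolourable :: "graph \<Rightarrow> nat \<Rightarrow> bool" where
  "cocolourable G k \<longleftrightarrow>
     (\<exists>P. disjoint_family_on P {..<k} \<and> (\<Union>i<k. P i) = verts G \<and>
          (\<forall>i<k. independent_in G (P i) \<or> clique_in G (P i)))"

definition cochromatic_number :: "graph \<Rightarrow> nat" where
  "cochromatic_number G = (LEAST k. cocolourable G k)"

type_synonym graph_property = "graph set"

definition cochromatic_at_most :: "nat \<Rightarrow> graph_property" where
  "cochromatic_at_most k = {G. simple_graph G \<and> cochromatic_number G \<le> k}"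

definition graph_dist :: "graph \<Rightarrow> graph \<Rightarrow> real" where
  "graph_dist G G' = real (card (sym_diff (edges G) (edges G'))) / (real (card (verts G)))\<^sup>2"

text \<open>
  The minimum over the finitely many competitors exceeds the parameter iff every competitor does;
  a graph without any competitor in the property counts as far from it.
\<close>

definition far_from :: "real \<Rightarrow> graph_property \<Rightarrow> graph \<Rightarrow> bool" where
  "far_from \<epsilon> \<F> G \<longleftrightarrow> (\<forall>G'\<in>\<F>. verts G' = verts G \<longrightarrow> graph_dist G G' > \<epsilon>)"

section \<open>Randomized oracle algorithms\<close>

text \<open>
  A randomized adaptive algorithm is a well-founded strategy tree: it can decide, request a sample
  of a given size, ask for the adjacency of two labels, or use internal randomness drawn from an
  arbitrary discrete distribution.  It is not given the graph or its number of vertices.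
\<close>

datatype algorithm =
    Decide bool
  | Sample nat "nat list \<Rightarrow> algorithm"
  | Query nat nat "bool \<Rightarrow> algorithm"
  | Random "nat pmf" "nat \<Rightarrow> algorithm"

text \<open>
  A request larger than the graph is answered by the list of all vertices (recognizable, since it
  is shorter than the request); the graph on them can then be read off by adjacency queries, which
  are counted as usual.  Otherwise the samples are drawn independently, with replacement.
\<close>

definition sample_reply :: "graph \<Rightarrow> nat \<Rightarrow> nat list pmf" where
  "sample_reply G s =
     (if s > card (verts G) then return_pmf (sorted_list_of_set (verts G))
      else replicate_pmf s (pmf_of_set (verts G)))"

record outcome =
  accepts :: bool
  queries :: nat
  labels :: nat

text \<open>
  The last argument of \<open>execute\<close> is the set of vertices seen so far.  Only pairs of
  such vertices can be queried: a query naming a label that was merely guessed is counted, but is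
  always answered negatively, whatever the graph.  Labels are counted with multiplicity.
\<close>

primrec execute :: "graph \<Rightarrow> algorithm \<Rightarrow> nat set \<Rightarrow> outcome pmf" where
  "execute G (Decide b) S = return_pmf \<lparr>accepts = b, queries = 0, labels = 0\<rparr>"
| "execute G (Sample s f) S =
     bind_pmf (sample_reply G s) (\<lambda>xs.
       map_pmf (\<lambda>r. r\<lparr>labels := labels r + length xs\<rparr>) (execute G (f xs) (S \<union> set xs)))"
| "execute G (Query u v f) S =
     map_pmf (\<lambda>r. r\<lparr>queries := queries r + 1\<rparr>)
       (execute G (f (u \<in> S \<and> v \<in> S \<and> adjacent G u v)) S)"
| "execute G (Random p f) S = bind_pmf p (\<lambda>x. execute G (f x) S)"

definition accept_prob :: "algorithm \<Rightarrow> graph \<Rightarrow> real" where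
  "accept_prob A G = measure_pmf.prob (execute G A {}) {r. accepts r}"

definition reject_prob :: "algorithm \<Rightarrow> graph \<Rightarrow> real" where
  "reject_prob A G = measure_pmf.prob (execute G A {}) {r. \<not> accepts r}"

text \<open>Maxima over all input graphs and all outcomes; infinite if there is no common bound.\<close>

definition query_complexity :: "algorithm \<Rightarrow> enat" where
  "query_complexity A =
     (SUP G\<in>{G. simple_graph G}. SUP r\<in>set_pmf (execute G A {}). enat (queries r))"

definition sample_complexity :: "algorithm \<Rightarrow> enat" where
  "sample_complexity A =
     (SUP G\<in>{G. simple_graph G}. SUP r\<in>set_pmf (execute G A {}). enat (labels r))"

definition size_oblivious_tester :: "graph_property \<Rightarrow> (real \<Rightarrow> algorithm) \<Rightarrow> bool" where
  "size_oblivious_tester \<F> T \<longleftrightarrow>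
     (\<forall>\<epsilon>>0.
        (\<forall>G. simple_graph G \<and> G \<in> \<F> \<longrightarrow> accept_prob (T \<epsilon>) G \<ge> 2 / 3) \<and>
        (\<forall>G. simple_graph G \<and> far_from \<epsilon> \<F> G \<longrightarrow> reject_prob (T \<epsilon>) G \<ge> 2 / 3) \<and>
        query_complexity (T \<epsilon>) < \<infinity> \<and> sample_complexity (T \<epsilon>) < \<infinity>)"

definition one_sided :: "graph_property \<Rightarrow> (real \<Rightarrow> algorithm) \<Rightarrow> bool" where
  "one_sided \<F> T \<longleftrightarrow>
     (\<forall>\<epsilon>>0. \<forall>G. simple_graph G \<and> G \<in> \<F> \<longrightarrow> accept_prob (T \<epsilon>) G = 1)"

end

theory Submission
  imports Defs
begin

text \<open>
  The tester samples \<open>s = \<lceil>24 k / \<epsilon>\<^sup>2 \<sqdot> ln (2 + k / \<epsilon>)\<rceil>\<close> vertices, reads the graph on them, and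
  accepts iff that graph splits into \<open>k\<close> independent sets and cliques.  It has one-sided error
  because the property is hereditary, and it spends at most \<open>s\<^sup>2\<close> queries, which is
  \<open>O(k\<^sup>2 / \<epsilon>\<^sup>4)\<close> up to logarithms and hence stays below the stated bound for \<open>\<epsilon> < 1\<close>.  For
  \<open>\<epsilon> \<ge> 1\<close> no graph is far, since the edgeless graph is a competitor, and the tester
  accepts outright.

  The content is soundness.  Fix which of the \<open>k\<close> parts are to be cliques.  A partition is then
  a colouring in which two vertices of equal colour \<open>i\<close> must not be joined in the conflict graph
  of \<open>i\<close>, which is \<open>G\<close> or its complement.  Flipping all pairs in conflict turns a colouring into
  a valid one, so if \<open>G\<close> is \<open>\<epsilon>\<close>-far, every colouring of its \<open>n\<close> vertices has more than
  \<open>\<epsilon> n\<^sup>2\<close> conflicts.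

  Colour the samples one after another, keeping for every vertex the list of colours that the
  choices so far leave open.  Call a vertex pressing if each colour in its list, once used,
  would be struck from at least \<open>\<delta> n\<close> other lists, where \<open>\<delta> = \<epsilon> / 2\<close>; a vertex with empty list
  is pressing.  If there were fewer than \<open>\<delta> n\<close> pressing vertices, giving each other vertex a colour
  that witnesses that it is not pressing would leave at most \<open>2 \<delta> n\<^sup>2\<close> conflicts
  (\<open>many_pressing\<close>).  So a random vertex is pressing with probability at least \<open>\<delta>\<close>, and colouring
  a pressing vertex consumes \<open>\<delta> n\<close> of the at most \<open>k n\<close> list entries.

  Instead of following the branches of this process up to a concentration bound and a union
  bound over leaves, \<open>extension_prob_le\<close> tracks the potential
  \<open>(2 k) ^ (entries / (\<delta> n))\<close> in expectation: at a pressing vertex the up to \<open>k\<close>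
  branches each carry at most \<open>1 / (2 k)\<close> of it, so that it halves altogether; this yields a
  factor \<open>1 - \<delta> / 2\<close> per sample.  A union bound over the \<open>2 ^ k\<close> ways to choose the cliques
  finishes the proof.
\<close>

section \<open>List colourings of random samples\<close>

text \<open>
  The family \<open>H\<close> assigns to each colour its own conflict relation: in the application this is
  adjacency for a colour reserved for an independent set and non-adjacency for one reserved for a
  clique.  Conflicts are unordered pairs because they will be counted as edges to be flipped.
\<close>

definition conflicts :: "('c \<Rightarrow> 'v \<Rightarrow> 'v \<Rightarrow> bool) \<Rightarrow> 'v set \<Rightarrow> ('v \<Rightarrow> 'c) \<Rightarrow> 'v set set" where
  "conflicts H V c = {{u, v} | u v. u \<in> V \<and> v \<in> V \<and> c u = c v \<and> H (c u) u v}"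

definition restrict_lists ::
    "('c \<Rightarrow> 'v \<Rightarrow> 'v \<Rightarrow> bool) \<Rightarrow> 'v \<Rightarrow> 'c \<Rightarrow> ('v \<Rightarrow> 'c set) \<Rightarrow> ('v \<Rightarrow> 'c set)" where
  "restrict_lists H x i L = (\<lambda>u. if H i x u then L u - {i} else L u)"

definition struck :: "('c \<Rightarrow> 'v \<Rightarrow> 'v \<Rightarrow> bool) \<Rightarrow> 'v set \<Rightarrow> ('v \<Rightarrow> 'c set) \<Rightarrow> 'v \<Rightarrow> 'c \<Rightarrow> 'v set" where
  "struck H V L x i = {u \<in> V. i \<in> L u \<and> H i x u}"

definition pressing ::
    "('c \<Rightarrow> 'v \<Rightarrow> 'v \<Rightarrow> bool) \<Rightarrow> 'v set \<Rightarrow> real \<Rightarrow> ('v \<Rightarrow> 'c set) \<Rightarrow> 'v set" where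
  "pressing H V \<delta> L = {x \<in> V. \<forall>i\<in>L x. \<delta> * card V \<le> card (struck H V L x i)}"

text \<open>
  The samples are coloured in order of arrival.  Repetitions of a vertex may receive different
  colours; this only makes extension easier, and soundness needs an upper bound on its
  probability.
\<close>

primrec extendable ::
    "('c \<Rightarrow> 'v \<Rightarrow> 'v \<Rightarrow> bool) \<Rightarrow> ('v \<Rightarrow> 'c set) \<Rightarrow> 'v list \<Rightarrow> bool" where
  "extendable H L [] = True"
| "extendable H L (x # xs) = (\<exists>i\<in>L x. extendable H (restrict_lists H x i L) xs)"

lemma extendable_mono:
  assumes "extendable H L xs" and "\<And>u. L u \<subseteq> L' u"
  shows "extendable H L' xs"
  using assms
proof (induction xs arbitrary: L L')
  case (Cons x xs)
  from Cons.prems(1) obtain i where i: "i \<in> L x" "extendable H (restrict_lists H x i L) xs"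
    by auto
  have "extendable H (restrict_lists H x i L') xs"
    by (rule Cons.IH[OF i(2)]) (use Cons.prems(2) in \<open>auto simp: restrict_lists_def\<close>)
  then show ?case using i(1) Cons.prems(2) by auto
qed simp

lemma extendable_if_proper_colouring:
  assumes "\<And>u. u \<in> set xs \<Longrightarrow> c u \<in> L u"
    and "\<And>u v. u \<in> set xs \<Longrightarrow> v \<in> set xs \<Longrightarrow> c u = c v \<Longrightarrow> \<not> H (c u) u v"
  shows "extendable H L xs"
  using assms
proof (induction xs arbitrary: L)
  case (Cons x xs)
  have "extendable H (restrict_lists H x (c x) L) xs"
  proof (rule Cons.IH)
    fix u assume u: "u \<in> set xs"
    show "c u \<in> restrict_lists H x (c x) L u"
      using Cons.prems(1)[of u] Cons.prems(2)[of x u] u by (auto simp: restrict_lists_def)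
  qed (use Cons.prems in auto)
  then show ?case using Cons.prems(1)[of x] by auto
qed simp

lemma sum_card_restrict_lists:
  assumes "finite V" and "\<And>u. u \<in> V \<Longrightarrow> finite (L u)"
  shows "(\<Sum>u\<in>V. card (restrict_lists H x i L u)) + card (struck H V L x i) = (\<Sum>u\<in>V. card (L u))"
proof -
  have "card (struck H V L x i) = (\<Sum>u\<in>V. if i \<in> L u \<and> H i x u then 1 else 0)"
    using assms(1) by (simp add: struck_def sum.If_cases Int_def)
  moreover have "card (restrict_lists H x i L u) + (if i \<in> L u \<and> H i x u then 1 else 0) = card (L u)"
    if "u \<in> V" for u
  proof (cases "i \<in> L u")
    case True
    then have "card (L u) > 0" using assms(2)[OF that] card_gt_0_iff by blast
    then show ?thesis using True by (auto simp: restrict_lists_def)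
  qed (auto simp: restrict_lists_def)
  ultimately show ?thesis by (simp flip: sum.distrib)
qed

text \<open>
  If few vertices press, colour every other vertex by a colour that prevents it from pressing.
  A pair in conflict either meets a pressing vertex or is struck by one of its ends, and both kinds
  are few.
\<close>

lemma many_pressing:
  fixes V :: "'v set" and H :: "'c \<Rightarrow> 'v \<Rightarrow> 'v \<Rightarrow> bool"
  assumes V: "finite V" and C: "C \<noteq> {}"
    and L: "\<And>u. u \<in> V \<Longrightarrow> L u \<subseteq> C"
    and far: "\<And>c. c ` V \<subseteq> C \<Longrightarrow> 2 * \<delta> * (real (card V))\<^sup>2 < card (conflicts H V c)"
  shows "\<delta> * card V \<le> card (pressing H V \<delta> L)"
proof (rule ccontr)
  assume few: "\<not> ?thesis"
  define W where "W = pressing H V \<delta> L"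
  have WV: "W \<subseteq> V" by (auto simp: W_def pressing_def)
  obtain a where a: "a \<in> C" using C by auto
  \<comment> \<open>The colour of a pressing vertex is arbitrary, since all its pairs are given up.\<close>
  define c where
    "c x = (if x \<in> W then a else SOME i. i \<in> L x \<and> card (struck H V L x i) < \<delta> * card V)" for x
  have c: "c x \<in> L x \<and> card (struck H V L x (c x)) < \<delta> * card V" if "x \<in> V - W" for x
  proof -
    have "\<exists>i. i \<in> L x \<and> card (struck H V L x i) < \<delta> * card V"
      using that by (auto simp: W_def pressing_def not_le)
    from someI_ex[OF this] show ?thesis using that by (simp add: c_def)
  qed
  let ?S = "SIGMA x : V - W. struck H V L x (c x)"
  have fin: "finite (struck H V L x i)" for x i using V by (simp add: struck_def)
  have fins: "finite (W \<times> V)" "finite (V \<times> W)" "finite ?S"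
    using V WV fin by (auto intro: finite_subset)
  have swap: "(\<lambda>(u, v). {u, v}) ` (V \<times> W) \<subseteq> (\<lambda>(u, v). {u, v}) ` (W \<times> V)"
    by (auto simp: insert_commute image_iff)
  have "conflicts H V c \<subseteq> (\<lambda>(u, v). {u, v}) ` (W \<times> V \<union> V \<times> W \<union> ?S)"
  proof
    fix e assume "e \<in> conflicts H V c"
    then obtain u v where uv: "e = {u, v}" "u \<in> V" "v \<in> V" "c u = c v" "H (c u) u v"
      by (auto simp: conflicts_def)
    have "(u, v) \<in> W \<times> V \<union> V \<times> W \<union> ?S"
      using uv c[of v] by (auto simp: struck_def)
    then show "e \<in> (\<lambda>(u, v). {u, v}) ` (W \<times> V \<union> V \<times> W \<union> ?S)"
      using uv(1) by (metis (mono_tags, lifting) case_prod_conv image_eqI)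
  qed
  also have "\<dots> \<subseteq> (\<lambda>(u, v). {u, v}) ` (W \<times> V \<union> ?S)"
    using swap by (simp add: image_Un) blast
  finally have "card (conflicts H V c) \<le> card (W \<times> V \<union> ?S)"
    using fins by (meson card_image_le card_mono finite_UnI finite_imageI le_trans)
  also have "\<dots> \<le> card W * card V + (\<Sum>x\<in>V - W. card (struck H V L x (c x)))"
    using card_Un_le[of "W \<times> V" ?S] V fin by (simp add: card_cartesian_product)
  finally have "real (card (conflicts H V c)) \<le>
      real (card W) * real (card V) + (\<Sum>x\<in>V - W. real (card (struck H V L x (c x))))"
    by (simp flip: of_nat_add of_nat_mult of_nat_sum)
  also have "(\<Sum>x\<in>V - W. real (card (struck H V L x (c x)))) \<le> (\<Sum>x\<in>V - W. \<delta> * card V)"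
    by (rule sum_mono) (use c in force)
  also have "\<dots> = card (V - W) * (\<delta> * card V)" by simp
  also have "\<dots> \<le> card V * (\<delta> * card V)"
  proof (rule mult_right_mono)
    show "real (card (V - W)) \<le> card V" using V by (simp add: card_mono)
    show "0 \<le> \<delta> * card V" using few by (smt (verit) of_nat_0_le_iff)
  qed
  also have "real (card W) * real (card V) \<le> (\<delta> * card V) * card V"
    using few by (intro mult_right_mono) (auto simp: W_def)
  finally have "card (conflicts H V c) \<le> 2 * \<delta> * (real (card V))\<^sup>2"
    by (simp add: power2_eq_square algebra_simps)
  moreover have "c ` V \<subseteq> C"
  proof
    fix y assume "y \<in> c ` V"
    then obtain x where "x \<in> V" "y = c x" by auto
    then show "y \<in> C" using a c[of x] L[of x] by (cases "x \<in> W") (auto simp: c_def)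
  qed
  ultimately show False using far[of c] by simp
qed

lemma prob_replicate_pmf_of_set_Suc:
  assumes "finite V" "V \<noteq> {}"
  shows "measure_pmf.prob (replicate_pmf (Suc t) (pmf_of_set V)) {xs. P xs} =
    (\<Sum>x\<in>V. measure_pmf.prob (replicate_pmf t (pmf_of_set V)) {xs. P (x # xs)}) / card V"
proof -
  have fin: "finite (set_pmf (replicate_pmf t (pmf_of_set V)))" for t
    using assms finite_lists_length_eq[of V t]
    by (auto simp: set_replicate_pmf lists_eq_set Collect_conj_eq)
  have "measure_pmf.prob (replicate_pmf (Suc t) (pmf_of_set V)) {xs. P xs} =
     measure_pmf.expectation (pmf_of_set V \<bind>
       (\<lambda>x. map_pmf (Cons x) (replicate_pmf t (pmf_of_set V)))) (indicator {xs. P xs})"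
    by (simp add: map_pmf_def)
  also have "\<dots> = (\<Sum>x\<in>V. measure_pmf.prob (replicate_pmf t (pmf_of_set V)) {xs. P (x # xs)}) / card V"
    using assms fin
    by (subst pmf_expectation_bind_pmf_of_set)
       (auto simp: sum_distrib_left vimage_def divide_inverse_commute)
  finally show ?thesis .
qed

text \<open>
  By induction on the number of samples.  The exponent counts how many pressing vertices can still
  be coloured before the lists run out of entries.  A first sample that presses halves the bound;
  any other is ignored, which only helps extension.
\<close>

lemma extension_prob_le:
  fixes V :: "'v set" and H :: "'c \<Rightarrow> 'v \<Rightarrow> 'v \<Rightarrow> bool" and \<delta> :: real
  assumes V: "finite V" "V \<noteq> {}" and C: "finite C" "C \<noteq> {}" and \<delta>: "0 < \<delta>" "\<delta> \<le> 1"
    and far: "\<And>c. c ` V \<subseteq> C \<Longrightarrow> 2 * \<delta> * (real (card V))\<^sup>2 < card (conflicts H V c)"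
    and L: "\<And>u. u \<in> V \<Longrightarrow> L u \<subseteq> C"
  shows "measure_pmf.prob (replicate_pmf t (pmf_of_set V)) {xs. extendable H L xs}
      \<le> (2 * card C) powr ((\<Sum>u\<in>V. card (L u)) / (\<delta> * card V)) * (1 - \<delta> / 2) ^ t"
  using L
proof (induction t arbitrary: L)
  case 0
  have "card C > 0" using C by (simp add: card_gt_0_iff)
  then show ?case using \<delta> by (simp add: ge_one_powr_ge_zero sum_nonneg)
next
  case (Suc t)
  let ?p = "\<lambda>L. measure_pmf.prob (replicate_pmf t (pmf_of_set V)) {xs. extendable H L xs}"
  let ?m = "\<lambda>L. real (\<Sum>u\<in>V. card (L u)) / (\<delta> * card V)"
  define A :: real where "A = 2 * card C"
  define q where "q = 1 - \<delta> / 2"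
  define B where "B = A powr ?m L * q ^ t"
  define W where "W = pressing H V \<delta> L"
  have n: "card V > 0" using V by (simp add: card_gt_0_iff)
  have "card C > 0" using C by (simp add: card_gt_0_iff)
  then have A: "A \<ge> 2" by (simp add: A_def)
  have q: "q \<ge> 0" using \<delta> by (simp add: q_def)
  have B: "B \<ge> 0" using q by (simp add: B_def)
  have WV: "W \<subseteq> V" by (auto simp: W_def pressing_def)
  have IH: "?p L' \<le> A powr ?m L' * q ^ t" if "\<And>u. u \<in> V \<Longrightarrow> L' u \<subseteq> C" for L'
    using Suc.IH[of L'] that by (simp add: A_def q_def)
  have finL: "finite (L u)" if "u \<in> V" for u using Suc.prems[OF that] C(1) finite_subset by blast
  have restr: "restrict_lists H x i L u \<subseteq> L u" for x i u by (auto simp: restrict_lists_def)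
  have any: "measure_pmf.prob (replicate_pmf t (pmf_of_set V)) {xs. extendable H L (x # xs)} \<le> B" for x
  proof -
    have "measure_pmf.prob (replicate_pmf t (pmf_of_set V)) {xs. extendable H L (x # xs)} \<le> ?p L"
      using extendable_mono[OF _ restr] by (intro measure_pmf.finite_measure_mono) auto
    also have "\<dots> \<le> B" unfolding B_def by (rule IH) (rule Suc.prems)
    finally show ?thesis .
  qed
  have halved: "measure_pmf.prob (replicate_pmf t (pmf_of_set V)) {xs. extendable H L (x # xs)} \<le> B / 2"
    if x: "x \<in> W" for x
  proof -
    have xV: "x \<in> V" using x WV by auto
    have "{xs. extendable H L (x # xs)} = (\<Union>i\<in>L x. {xs. extendable H (restrict_lists H x i L) xs})"
      by auto
    then have "measure_pmf.prob (replicate_pmf t (pmf_of_set V)) {xs. extendable H L (x # xs)}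
        \<le> (\<Sum>i\<in>L x. ?p (restrict_lists H x i L))"
      using finL[OF xV] by (simp add: measure_UNION_le)
    \<comment> \<open>Each branch has lost \<open>\<delta> n\<close> entries, that is, one unit of the exponent.\<close>
    also have "\<dots> \<le> (\<Sum>i\<in>L x. B / A)"
    proof (rule sum_mono)
      fix i assume i: "i \<in> L x"
      have "\<delta> * card V \<le> card (struck H V L x i)" using x i by (auto simp: W_def pressing_def)
      moreover have "real (\<Sum>u\<in>V. card (restrict_lists H x i L u)) + card (struck H V L x i)
          = real (\<Sum>u\<in>V. card (L u))"
        by (simp only: of_nat_add[symmetric] sum_card_restrict_lists[OF V(1) finL])
      ultimately have "real (\<Sum>u\<in>V. card (restrict_lists H x i L u)) \<le>
          real (\<Sum>u\<in>V. card (L u)) - \<delta> * card V" by linarith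
      then have "?m (restrict_lists H x i L) \<le> (real (\<Sum>u\<in>V. card (L u)) - \<delta> * card V) / (\<delta> * card V)"
        using \<delta> n by (intro divide_right_mono) auto
      also have "\<dots> = ?m L - 1" using \<delta> n by (simp add: diff_divide_distrib)
      finally have "A powr ?m (restrict_lists H x i L) \<le> A powr (?m L - 1)"
        using A by (intro powr_mono) auto
      also have "\<dots> = A powr ?m L / A" using A by (simp add: powr_diff)
      finally have "A powr ?m (restrict_lists H x i L) * q ^ t \<le> A powr ?m L / A * q ^ t"
        using q by (intro mult_right_mono) auto
      moreover have "?p (restrict_lists H x i L) \<le> A powr ?m (restrict_lists H x i L) * q ^ t"
        by (rule IH) (use restr Suc.prems in blast)
      ultimately show "?p (restrict_lists H x i L) \<le> B / A" by (simp add: B_def)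
    qed
    also have "\<dots> = card (L x) * (B / A)" by simp
    also have "\<dots> \<le> card C * (B / A)"
      using A B Suc.prems[OF xV] C(1) by (intro mult_right_mono) (auto simp: card_mono)
    also have "\<dots> = B / 2" using \<open>card C > 0\<close> by (simp add: A_def)
    finally show ?thesis .
  qed
  have "measure_pmf.prob (replicate_pmf (Suc t) (pmf_of_set V)) {xs. extendable H L xs}
      = (\<Sum>x\<in>V. measure_pmf.prob (replicate_pmf t (pmf_of_set V)) {xs. extendable H L (x # xs)}) / card V"
    by (rule prob_replicate_pmf_of_set_Suc[OF V])
  also have "\<dots> \<le> (\<Sum>x\<in>V. B - (if x \<in> W then B / 2 else 0)) / card V"
    using any halved by (intro divide_right_mono sum_mono) auto
  also have "(\<Sum>x\<in>V. B - (if x \<in> W then B / 2 else 0)) = card V * B - card W * (B / 2)"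
    using V WV by (simp add: sum_subtractf sum.If_cases Int_absorb1)
  also have "\<dots> / card V \<le> (card V * B - \<delta> * card V * (B / 2)) / card V"
    using many_pressing[OF V(1) C(2) Suc.prems far] B
    by (intro divide_right_mono diff_left_mono mult_right_mono) (auto simp: W_def)
  also have "\<dots> = B * q" using n by (simp add: q_def field_simps)
  also have "B * q = A powr ?m L * q ^ Suc t" by (simp add: B_def)
  finally show ?case unfolding A_def q_def .
qed

section \<open>Cocolourings as proper list colourings\<close>

lemma cocolourable_mono:
  assumes "cocolourable G j" "j \<le> k"
  shows "cocolourable G k"
proof -
  from assms(1) obtain P where P: "disjoint_family_on P {..<j}" "(\<Union>i<j. P i) = verts G"
    "\<forall>i<j. independent_in G (P i) \<or> clique_in G (P i)"
    unfolding cocolourable_def by blast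
  let ?P = "\<lambda>i. if i < j then P i else {}"
  have "(\<Union>i<k. ?P i) = (\<Union>i<j. P i)"
    using assms(2) by (auto intro: less_le_trans split: if_splits)
  then have "(\<Union>i<k. ?P i) = verts G" using P(2) by simp
  moreover have "disjoint_family_on ?P {..<k}"
    using P(1) by (auto simp: disjoint_family_on_def)
  moreover have "\<forall>i<k. independent_in G (?P i) \<or> clique_in G (?P i)"
    using P(3) by (auto simp: independent_in_def)
  ultimately show ?thesis unfolding cocolourable_def by blast
qed

text \<open>Here \<open>\<tau>\<close> is the set of the colours that are reserved for cliques.\<close>

definition conflict_rel :: "graph \<Rightarrow> nat set \<Rightarrow> nat \<Rightarrow> nat \<Rightarrow> nat \<Rightarrow> bool" where
  "conflict_rel G \<tau> i u v \<longleftrightarrow> u \<noteq> v \<and> adjacent G u v \<noteq> (i \<in> \<tau>)"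

text \<open>
  Choosing \<open>\<tau>\<close> once for the whole partition replaces the disjunction at each part, which leaves a
  plain colouring problem for every fixed \<open>\<tau>\<close>.
\<close>

lemma cocolourable_iff_proper_colouring:
  "cocolourable G k \<longleftrightarrow> (\<exists>\<tau>\<subseteq>{..<k}. \<exists>c. c ` verts G \<subseteq> {..<k} \<and>
     (\<forall>u\<in>verts G. \<forall>v\<in>verts G. c u = c v \<longrightarrow> \<not> conflict_rel G \<tau> (c u) u v))"
  (is "_ \<longleftrightarrow> ?R")
proof
  assume "cocolourable G k"
  then obtain P where P: "disjoint_family_on P {..<k}" "(\<Union>i<k. P i) = verts G"
    "\<forall>i<k. independent_in G (P i) \<or> clique_in G (P i)"
    unfolding cocolourable_def by blast
  define \<tau> where "\<tau> = {i. i < k \<and> \<not> independent_in G (P i)}"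
  have "\<forall>u\<in>verts G. \<exists>i<k. u \<in> P i" using P(2) by blast
  then obtain c where c: "\<And>u. u \<in> verts G \<Longrightarrow> c u < k \<and> u \<in> P (c u)" by metis
  have "\<not> conflict_rel G \<tau> (c u) u v" if "u \<in> verts G" "v \<in> verts G" "c u = c v" for u v
    using c[OF that(1)] c[OF that(2)] that(3) P(3)
    by (auto simp: conflict_rel_def \<tau>_def independent_in_def clique_in_def)
  then show ?R using c by (intro exI[of _ \<tau>] conjI exI[of _ c]) (auto simp: \<tau>_def)
next
  assume ?R
  then obtain \<tau> c where c: "c ` verts G \<subseteq> {..<k}"
    "\<forall>u\<in>verts G. \<forall>v\<in>verts G. c u = c v \<longrightarrow> \<not> conflict_rel G \<tau> (c u) u v"
    by auto
  show "cocolourable G k" unfolding cocolourable_def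
  proof (intro exI[of _ "\<lambda>i. {u \<in> verts G. c u = i}"] conjI)
    show "\<forall>i<k. independent_in G {u \<in> verts G. c u = i} \<or> clique_in G {u \<in> verts G. c u = i}"
    proof (intro allI impI)
      fix i
      have "adjacent G u v \<longleftrightarrow> i \<in> \<tau>"
        if "u \<in> verts G" "v \<in> verts G" "c u = i" "c v = i" "u \<noteq> v" for u v
        using bspec[OF bspec[OF c(2) that(1)] that(2)] that by (simp add: conflict_rel_def)
      then show "independent_in G {u \<in> verts G. c u = i} \<or> clique_in G {u \<in> verts G. c u = i}"
        by (cases "i \<in> \<tau>") (simp_all add: independent_in_def clique_in_def)
    qed
  qed (use c(1) in \<open>auto simp: disjoint_family_on_def\<close>)
qed

lemma cocolourable_card_verts:
  assumes "finite (verts G)"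
  shows "cocolourable G (card (verts G))"
proof -
  obtain h where h: "bij_betw h (verts G) {0..<card (verts G)}"
    using ex_bij_betw_finite_nat[OF assms] by blast
  then have "h u = h v \<longleftrightarrow> u = v" if "u \<in> verts G" "v \<in> verts G" for u v
    using that by (metis bij_betw_imp_inj_on inj_onD)
  moreover have "h ` verts G \<subseteq> {..<card (verts G)}"
    using h by (simp add: bij_betw_def atLeast0LessThan)
  ultimately show ?thesis unfolding cocolourable_iff_proper_colouring
    by (intro exI[of _ "{}"] conjI exI[of _ h]) (simp_all add: conflict_rel_def)
qed

lemma cochromatic_at_most_iff:
  "G \<in> cochromatic_at_most k \<longleftrightarrow> simple_graph G \<and> cocolourable G k"
proof -
  have "cochromatic_number G \<le> k \<longleftrightarrow> cocolourable G k" if "simple_graph G"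
  proof
    have "cocolourable G (cochromatic_number G)"
      unfolding cochromatic_number_def
      by (rule LeastI[of "cocolourable G"], rule cocolourable_card_verts)
         (use that in \<open>simp add: simple_graph_def\<close>)
    then show "cochromatic_number G \<le> k \<Longrightarrow> cocolourable G k" by (rule cocolourable_mono)
  qed (simp add: cochromatic_number_def Least_le)
  then show ?thesis by (auto simp: cochromatic_at_most_def)
qed

definition induced :: "graph \<Rightarrow> nat set \<Rightarrow> graph" where
  "induced G S = \<lparr>verts = S, edges = {e \<in> edges G. e \<subseteq> S}\<rparr>"

lemma adjacent_induced: "u \<in> S \<Longrightarrow> v \<in> S \<Longrightarrow> adjacent (induced G S) u v = adjacent G u v"
  by (auto simp: induced_def adjacent_def)

lemma conflict_rel_induced:
  "u \<in> S \<Longrightarrow> v \<in> S \<Longrightarrow> conflict_rel (induced G S) \<tau> i u v = conflict_rel G \<tau> i u v"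
  by (simp add: conflict_rel_def adjacent_induced)

lemma verts_induced [simp]: "verts (induced G S) = S"
  by (simp add: induced_def)

lemma cocolourable_induced:
  assumes "cocolourable G k" "S \<subseteq> verts G"
  shows "cocolourable (induced G S) k"
proof -
  from assms(1) obtain \<tau> c where "\<tau> \<subseteq> {..<k}" "c ` verts G \<subseteq> {..<k}"
    "\<forall>u\<in>verts G. \<forall>v\<in>verts G. c u = c v \<longrightarrow> \<not> conflict_rel G \<tau> (c u) u v"
    unfolding cocolourable_iff_proper_colouring by blast
  then show ?thesis using assms(2) unfolding cocolourable_iff_proper_colouring
    by (intro exI[of _ \<tau>] conjI exI[of _ c]) (auto simp: conflict_rel_induced subset_iff)
qed

lemma cocolourable_induced_verts:
  assumes "simple_graph G"
  shows "cocolourable (induced G (verts G)) k \<longleftrightarrow> cocolourable G k"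
  unfolding cocolourable_iff_proper_colouring by (auto simp: conflict_rel_induced)

text \<open>
  Flipping the pairs in conflict makes a colouring proper.  Two parts share no pair, so the flips
  do not interfere and their number is exactly the number of edges by which the graph changes.
\<close>

lemma conflicts_gt_if_far:
  assumes G: "simple_graph G" and far: "far_from \<epsilon> (cochromatic_at_most k) G"
    and c: "c ` verts G \<subseteq> {..<k}" and \<tau>: "\<tau> \<subseteq> {..<k}" and ne: "verts G \<noteq> {}"
  shows "\<epsilon> * (real (card (verts G)))\<^sup>2 < card (conflicts (conflict_rel G \<tau>) (verts G) c)"
proof -
  define D where "D = conflicts (conflict_rel G \<tau>) (verts G) c"
  define G' where "G' = \<lparr>verts = verts G, edges = sym_diff (edges G) D\<rparr>"
  have D: "{u, v} \<in> D \<longleftrightarrow> c u = c v \<and> conflict_rel G \<tau> (c u) u v"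
    if "u \<in> verts G" "v \<in> verts G" for u v
    using that by (auto simp: D_def conflicts_def doubleton_eq_iff conflict_rel_def adjacent_def
        insert_commute)
  have "simple_graph G'"
    using G by (auto simp: G'_def simple_graph_def D_def conflicts_def conflict_rel_def)
  moreover have "cocolourable G' k"
    unfolding cocolourable_iff_proper_colouring
  proof (intro exI[of _ \<tau>] conjI exI[of _ c] ballI impI)
    fix u v assume "u \<in> verts G'" "v \<in> verts G'" "c u = c v"
    then show "\<not> conflict_rel G' \<tau> (c u) u v"
      using D[of u v] by (auto simp: G'_def conflict_rel_def adjacent_def)
  qed (use \<tau> c in \<open>auto simp: G'_def\<close>)
  ultimately have "graph_dist G G' > \<epsilon>"
    using far by (simp add: far_from_def cochromatic_at_most_iff G'_def)
  moreover have "sym_diff (edges G) (edges G') = D" by (auto simp: G'_def)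
  moreover have "card (verts G) > 0" using ne G by (simp add: simple_graph_def card_gt_0_iff)
  ultimately show ?thesis by (simp add: graph_dist_def D_def pos_less_divide_eq)
qed

lemma extendable_if_cocolourable_induced:
  assumes "cocolourable (induced G (set xs)) k"
  shows "\<exists>\<tau>\<subseteq>{..<k}. extendable (conflict_rel G \<tau>) (\<lambda>_. {..<k}) xs"
proof -
  from assms obtain \<tau> c where "\<tau> \<subseteq> {..<k}" "c ` set xs \<subseteq> {..<k}"
    and "\<And>u v. u \<in> set xs \<Longrightarrow> v \<in> set xs \<Longrightarrow> c u = c v \<Longrightarrow> \<not> conflict_rel G \<tau> (c u) u v"
    unfolding cocolourable_iff_proper_colouring by (auto simp: conflict_rel_induced)
  then show ?thesis by (intro exI[of _ \<tau>] conjI extendable_if_proper_colouring[of _ c]) auto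
qed

lemma sampled_cocolourable_prob_le:
  assumes G: "simple_graph G" and far: "far_from \<epsilon> (cochromatic_at_most k) G"
    and ne: "verts G \<noteq> {}" and k: "k \<ge> 1" and \<epsilon>: "0 < \<epsilon>" "\<epsilon> \<le> 2"
  shows "measure_pmf.prob (replicate_pmf t (pmf_of_set (verts G))) {xs. cocolourable (induced G (set xs)) k}
     \<le> 2 ^ k * ((2 * real k) powr (2 * real k / \<epsilon>) * (1 - \<epsilon> / 4) ^ t)"
proof -
  let ?M = "replicate_pmf t (pmf_of_set (verts G))"
  let ?E = "\<lambda>\<tau>. {xs. extendable (conflict_rel G \<tau>) (\<lambda>_. {..<k}) xs}"
  have V: "finite (verts G)" using G by (simp add: simple_graph_def)
  then have n: "card (verts G) > 0" using ne by (simp add: card_gt_0_iff)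
  have "measure_pmf.prob ?M (?E \<tau>) \<le> (2 * real k) powr (2 * real k / \<epsilon>) * (1 - \<epsilon> / 4) ^ t"
    if \<tau>: "\<tau> \<subseteq> {..<k}" for \<tau>
  proof -
    have "measure_pmf.prob ?M (?E \<tau>) \<le> (2 * card {..<k}) powr
        ((\<Sum>u\<in>verts G. card {..<k}) / (\<epsilon> / 2 * card (verts G))) * (1 - \<epsilon> / 2 / 2) ^ t"
      by (rule extension_prob_le[where C = "{..<k}"])
         (use V ne k \<epsilon> conflicts_gt_if_far[OF G far _ \<tau> ne] in \<open>auto simp: lessThan_empty_iff\<close>)
    then show ?thesis using n \<epsilon> by (simp add: field_simps)
  qed
  then have "(\<Sum>\<tau>\<in>Pow {..<k}. measure_pmf.prob ?M (?E \<tau>)) \<le>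
      (\<Sum>\<tau>\<in>Pow {..<k}. (2 * real k) powr (2 * real k / \<epsilon>) * (1 - \<epsilon> / 4) ^ t)"
    by (intro sum_mono) auto
  also have "\<dots> = 2 ^ k * ((2 * real k) powr (2 * real k / \<epsilon>) * (1 - \<epsilon> / 4) ^ t)"
    by (simp add: card_Pow)
  finally have sum: "(\<Sum>\<tau>\<in>Pow {..<k}. measure_pmf.prob ?M (?E \<tau>)) \<le> \<dots>" .
  have "{xs. cocolourable (induced G (set xs)) k} \<subseteq> (\<Union>\<tau>\<in>Pow {..<k}. ?E \<tau>)"
    using extendable_if_cocolourable_induced by blast
  then have "measure_pmf.prob ?M {xs. cocolourable (induced G (set xs)) k}
      \<le> measure_pmf.prob ?M (\<Union>\<tau>\<in>Pow {..<k}. ?E \<tau>)"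
    by (intro measure_pmf.finite_measure_mono) auto
  also have "\<dots> \<le> (\<Sum>\<tau>\<in>Pow {..<k}. measure_pmf.prob ?M (?E \<tau>))"
    by (rule measure_UNION_le) auto
  finally show ?thesis using sum by linarith
qed

section \<open>The tester\<close>

primrec read_pairs :: "(nat \<times> nat) list \<Rightarrow> nat set set \<Rightarrow> (nat set set \<Rightarrow> bool) \<Rightarrow> algorithm" where
  "read_pairs [] E f = Decide (f E)"
| "read_pairs (p # ps) E f = Query (fst p) (snd p)
     (\<lambda>b. read_pairs ps (if b then insert {fst p, snd p} E else E) f)"

lemma execute_read_pairs:
  assumes "set ps \<subseteq> S \<times> S"
  shows "execute G (read_pairs ps E f) S = return_pmf
    \<lparr>accepts = f (E \<union> {{u, v} | u v. (u, v) \<in> set ps \<and> adjacent G u v}),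
     queries = length ps, labels = 0\<rparr>"
  using assms
proof (induction ps arbitrary: E)
  case (Cons p ps)
  obtain u v where p: "p = (u, v)" by (cases p)
  let ?E = "if adjacent G u v then insert {u, v} E else E"
  have E: "?E \<union> {{x, y} | x y. (x, y) \<in> set ps \<and> adjacent G x y} =
      E \<union> {{x, y} | x y. (x, y) \<in> set (p # ps) \<and> adjacent G x y}"
    by (auto simp: p)
  have ps: "set ps \<subseteq> S \<times> S" using Cons.prems by simp
  have "execute G (read_pairs (p # ps) E f) S =
      map_pmf (\<lambda>r. r\<lparr>queries := queries r + 1\<rparr>) (execute G (read_pairs ps ?E f) S)"
    using Cons.prems by (simp add: p)
  then show ?case unfolding Cons.IH[OF ps] E by simp
qed simp

text \<open>
  All ordered pairs are queried, a vertex paired with itself included; this loses a factor of about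
  two and makes the number of queries the square of the sample length.
\<close>

definition induced_tester :: "(graph \<Rightarrow> bool) \<Rightarrow> nat \<Rightarrow> algorithm" where
  "induced_tester P s = Sample s (\<lambda>xs. read_pairs (List.product xs xs) {}
     (\<lambda>E. P \<lparr>verts = set xs, edges = E\<rparr>))"

lemma edges_induced_eq_adjacent_pairs:
  assumes "simple_graph G"
  shows "{e \<in> edges G. e \<subseteq> S} = {{u, v} | u v. (u, v) \<in> S \<times> S \<and> adjacent G u v}"
proof (intro equalityI subsetI)
  fix e assume e: "e \<in> {e \<in> edges G. e \<subseteq> S}"
  then have "card e = 2" using assms by (auto simp: simple_graph_def)
  then obtain u v where "e = {u, v}" by (auto simp: card_2_iff)
  then show "e \<in> {{u, v} | u v. (u, v) \<in> S \<times> S \<and> adjacent G u v}"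
    using e by (auto simp: adjacent_def)
qed (auto simp: adjacent_def)

lemma execute_induced_tester:
  assumes "simple_graph G"
  shows "execute G (induced_tester P s) {} = map_pmf
    (\<lambda>xs. \<lparr>accepts = P (induced G (set xs)), queries = (length xs)\<^sup>2, labels = length xs\<rparr>)
    (sample_reply G s)"
  unfolding induced_tester_def map_pmf_def
  by (simp add: execute_read_pairs induced_def edges_induced_eq_adjacent_pairs[OF assms]
      bind_return_pmf power2_eq_square)

lemma set_sample_reply:
  assumes "finite (verts G)" "s > 0" "xs \<in> set_pmf (sample_reply G s)"
  shows "set xs \<subseteq> verts G" "length xs \<le> s"
proof -
  have "set xs \<subseteq> verts G \<and> length xs \<le> s"
  proof (cases "s > card (verts G)")
    case False
    then have "verts G \<noteq> {}" using assms(2) by auto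
    then show ?thesis using assms False by (auto simp: sample_reply_def set_replicate_pmf)
  qed (use assms in \<open>auto simp: sample_reply_def\<close>)
  then show "set xs \<subseteq> verts G" "length xs \<le> s" by auto
qed

lemma query_complexity_induced_tester:
  assumes "s > 0"
  shows "query_complexity (induced_tester P s) \<le> enat (s\<^sup>2)"
  unfolding query_complexity_def
proof (intro SUP_least)
  fix G r assume G: "G \<in> {G. simple_graph G}" and "r \<in> set_pmf (execute G (induced_tester P s) {})"
  then show "enat (queries r) \<le> enat (s\<^sup>2)"
    using set_sample_reply(2)[of G s] assms
    by (auto simp: execute_induced_tester simple_graph_def)
qed

lemma sample_complexity_induced_tester:
  assumes "s > 0"
  shows "sample_complexity (induced_tester P s) \<le> enat s"
  unfolding sample_complexity_def
proof (intro SUP_least)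
  fix G r assume G: "G \<in> {G. simple_graph G}" and "r \<in> set_pmf (execute G (induced_tester P s) {})"
  then show "enat (labels r) \<le> enat s"
    using set_sample_reply(2)[of G s] assms
    by (auto simp: execute_induced_tester simple_graph_def)
qed

lemma accept_prob_induced_tester:
  assumes "simple_graph G" "s > 0" and "\<And>S. S \<subseteq> verts G \<Longrightarrow> P (induced G S)"
  shows "accept_prob (induced_tester P s) G = 1"
  unfolding accept_prob_def
proof (rule measure_pmf.prob_eq_1[THEN iffD2])
  have "finite (verts G)" using assms(1) by (simp add: simple_graph_def)
  then show "AE r in measure_pmf (execute G (induced_tester P s) {}). r \<in> {r. accepts r}"
    using set_sample_reply(1)[of G s] assms
    by (auto simp: execute_induced_tester AE_measure_pmf_iff)
qed simp

text \<open>Every graph is within distance 1 of the edgeless graph on its vertices.\<close>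

lemma not_far_if_ge_1:
  assumes "simple_graph G" "k \<ge> 1" "\<epsilon> \<ge> 1"
  shows "\<not> far_from \<epsilon> (cochromatic_at_most k) G"
proof -
  let ?G = "\<lparr>verts = verts G, edges = {}\<rparr>" and ?n = "card (verts G)"
  have fin: "finite (verts G)" using assms(1) by (simp add: simple_graph_def)
  have "cocolourable ?G k"
    unfolding cocolourable_iff_proper_colouring
    using assms(2) by (intro exI[of _ "{}"] conjI exI[of _ "\<lambda>_. 0"])
      (simp_all add: conflict_rel_def adjacent_def image_subset_iff)
  then have G': "?G \<in> cochromatic_at_most k"
    using fin by (simp add: cochromatic_at_most_iff simple_graph_def)
  have "edges G \<subseteq> (\<lambda>(u, v). {u, v}) ` (verts G \<times> verts G)"
  proof
    fix e assume e: "e \<in> edges G"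
    then have "card e = 2" "e \<subseteq> verts G" using assms(1) by (auto simp: simple_graph_def)
    then obtain u v where "e = {u, v}" "u \<in> verts G" "v \<in> verts G" by (auto simp: card_2_iff)
    then show "e \<in> (\<lambda>(u, v). {u, v}) ` (verts G \<times> verts G)"
      by (intro image_eqI[of _ _ "(u, v)"]) auto
  qed
  then have "card (edges G) \<le> card (verts G \<times> verts G)"
    using fin by (meson card_image_le card_mono finite_SigmaI finite_imageI le_trans)
  then have "real (card (edges G)) \<le> (real ?n)\<^sup>2"
    by (simp add: card_cartesian_product power2_eq_square flip: of_nat_mult)
  then have "graph_dist G ?G \<le> 1"
    by (cases "?n = 0") (simp_all add: graph_dist_def divide_le_eq_1)
  then show ?thesis using G' assms(3) by (force simp: far_from_def)
qed

text \<open>See \<open>sample_size_sufficient\<close> for the constant.\<close>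

definition sample_size :: "nat \<Rightarrow> real \<Rightarrow> nat" where
  "sample_size k \<epsilon> = nat \<lceil>24 * k / \<epsilon>\<^sup>2 * ln (2 + k / \<epsilon>)\<rceil>"

lemma ln_two_plus_ge_1:
  assumes "1 \<le> (x::real)"
  shows "1 \<le> ln (2 + x)"
proof -
  have "exp 1 \<le> 2 + x" using exp_le assms by linarith
  then show ?thesis using assms by (simp add: ln_ge_iff)
qed

text \<open>
  In logarithms the claim is \<open>k ln 2 + (2 k / \<epsilon>) ln (2 k) + ln 3 \<le> s \<epsilon> / 4\<close>.  With
  \<open>x = k / \<epsilon> \<ge> 1\<close> and \<open>l = ln (2 + x)\<close>, the three terms are at most \<open>x l\<close>, \<open>4 x l\<close> and
  \<open>x l\<close>, the second one by \<open>2 k \<le> (2 + x)\<^sup>2\<close>; this is where the constant 24 comes from.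
\<close>

lemma sample_size_sufficient:
  fixes \<epsilon> :: real
  assumes k: "k \<ge> 1" and \<epsilon>: "0 < \<epsilon>" "\<epsilon> < 1" and s: "sample_size k \<epsilon> \<le> s"
  shows "2 ^ k * ((2 * real k) powr (2 * real k / \<epsilon>) * (1 - \<epsilon> / 4) ^ s) \<le> 1 / 3"
proof -
  define x where "x = k / \<epsilon>"
  define l where "l = ln (2 + x)"
  have kx: "real k \<le> x" using k \<epsilon> by (simp add: x_def field_simps mult_left_le)
  then have x1: "1 \<le> x" using k by linarith
  have l1: "1 \<le> l" unfolding l_def by (rule ln_two_plus_ge_1[OF x1])
  have "24 * k / \<epsilon>\<^sup>2 * l \<le> s"
    using s unfolding sample_size_def l_def x_def by linarith
  then have "24 * k / \<epsilon>\<^sup>2 * l * (\<epsilon> / 4) \<le> s * (\<epsilon> / 4)"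
    using \<epsilon> by (intro mult_right_mono) auto
  moreover have "24 * k / \<epsilon>\<^sup>2 * l * (\<epsilon> / 4) = 6 * (x * l)"
    using \<epsilon> by (simp add: x_def power2_eq_square field_simps)
  ultimately have large: "6 * (x * l) \<le> s * (\<epsilon> / 4)" by linarith
  have "k * ln 2 \<le> x * l"
  proof (rule mult_mono)
    show "ln 2 \<le> l" unfolding l_def using x1 by (intro ln_mono) auto
  qed (use kx x1 in auto)
  moreover have "2 * x * ln (2 * k) \<le> 4 * (x * l)"
  proof -
    have "(2 + x)\<^sup>2 = 4 + 4 * x + x\<^sup>2" by (simp add: power2_eq_square algebra_simps)
    then have "2 * real k \<le> (2 + x)\<^sup>2" using kx x1 zero_le_power2[of x] by linarith
    then have "ln (2 * real k) \<le> ln ((2 + x)\<^sup>2)" using k by (intro ln_mono) auto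
    also have "\<dots> = 2 * l" using x1 by (simp add: l_def ln_realpow)
    finally have "ln (2 * real k) \<le> 2 * l" .
    then have "2 * x * ln (2 * k) \<le> 2 * x * (2 * l)" using x1 by (intro mult_left_mono) auto
    then show ?thesis by simp
  qed
  moreover have "ln 3 \<le> x * l"
  proof -
    have "ln 3 \<le> l" unfolding l_def using x1 by (intro ln_mono) auto
    also have "\<dots> \<le> x * l" using x1 l1 by simp
    finally show ?thesis .
  qed
  ultimately have exponent: "k * ln 2 + 2 * x * ln (2 * k) - s * (\<epsilon> / 4) \<le> - ln 3"
    using large by linarith
  have "(1 - \<epsilon> / 4) ^ s \<le> exp (- \<epsilon> / 4) ^ s"
    using exp_ge_add_one_self[of "- \<epsilon> / 4"] \<epsilon> by (intro power_mono) auto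
  also have "\<dots> = exp (- (s * (\<epsilon> / 4)))" by (simp flip: exp_of_nat_mult)
  finally have "2 ^ k * ((2 * real k) powr (2 * real k / \<epsilon>) * (1 - \<epsilon> / 4) ^ s) \<le>
      2 ^ k * ((2 * real k) powr (2 * real k / \<epsilon>) * exp (- (s * (\<epsilon> / 4))))"
    by (intro mult_left_mono) auto
  also have "\<dots> = exp (k * ln 2) * (exp (2 * x * ln (2 * k)) * exp (- (s * (\<epsilon> / 4))))"
    using k by (simp add: powr_def x_def exp_of_nat_mult)
  also have "\<dots> = exp (k * ln 2 + 2 * x * ln (2 * k) - s * (\<epsilon> / 4))"
    by (simp flip: exp_add)
  also have "\<dots> \<le> exp (- ln 3)" using exponent by simp
  finally show ?thesis by (simp add: exp_minus)
qed

lemma sample_size_bounds: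
  fixes \<epsilon> :: real
  assumes k: "k \<ge> 1" and \<epsilon>: "0 < \<epsilon>" "\<epsilon> < 1"
  shows "0 < sample_size k \<epsilon>"
    and "(real (sample_size k \<epsilon>))\<^sup>2 \<le> 625 * (real k ^ 7 / \<epsilon> ^ 6) * ln (2 + k / \<epsilon>) ^ 2"
proof -
  define l where "l = ln (2 + k / \<epsilon>)"
  define y where "y = k / \<epsilon>\<^sup>2"
  have "1 \<le> k / \<epsilon>" using k \<epsilon> by simp
  then have l1: "1 \<le> l" unfolding l_def by (rule ln_two_plus_ge_1)
  have "\<epsilon>\<^sup>2 \<le> 1" using \<epsilon> by (simp add: power_le_one)
  then have y1: "1 \<le> y" using k \<epsilon> by (simp add: y_def)
  have yl: "1 \<le> y * l" using y1 l1 by (metis mult_mono' mult_1 zero_le_one)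
  have eq: "sample_size k \<epsilon> = nat \<lceil>24 * (y * l)\<rceil>" by (simp add: sample_size_def y_def l_def mult.assoc)
  show "0 < sample_size k \<epsilon>" using yl unfolding eq by linarith
  have "real (sample_size k \<epsilon>) \<le> 25 * (y * l)" using yl unfolding eq by linarith
  then have "(real (sample_size k \<epsilon>))\<^sup>2 \<le> (25 * (y * l))\<^sup>2" by (intro power_mono) auto
  also have "\<dots> = 625 * y\<^sup>2 * l\<^sup>2" by (simp add: power_mult_distrib)
  also have "\<dots> \<le> 625 * (real k ^ 7 / \<epsilon> ^ 6) * l\<^sup>2"
  proof (intro mult_right_mono mult_left_mono)
    have "y\<^sup>2 = real k ^ 2 / \<epsilon> ^ 4" by (simp add: y_def power_divide flip: power_mult)
    also have "\<dots> \<le> real k ^ 7 / \<epsilon> ^ 6"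
      using k \<epsilon> by (intro frac_le power_increasing power_decreasing) auto
    finally show "y\<^sup>2 \<le> real k ^ 7 / \<epsilon> ^ 6" .
  qed auto
  finally show "(real (sample_size k \<epsilon>))\<^sup>2 \<le> 625 * (real k ^ 7 / \<epsilon> ^ 6) * ln (2 + k / \<epsilon>) ^ 2"
    by (simp add: l_def)
qed

lemma induced_tester_rejects_far:
  assumes G: "simple_graph G" and far: "far_from \<epsilon> (cochromatic_at_most k) G"
    and k: "k \<ge> 1" and \<epsilon>: "0 < \<epsilon>" "\<epsilon> < 1"
  shows "2 / 3 \<le> reject_prob (induced_tester (\<lambda>H. cocolourable H k) (sample_size k \<epsilon>)) G"
proof -
  let ?s = "sample_size k \<epsilon>"
  have fin: "finite (verts G)" using G by (simp add: simple_graph_def)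
  have rej: "reject_prob (induced_tester (\<lambda>H. cocolourable H k) ?s) G =
      measure_pmf.prob (sample_reply G ?s) {xs. \<not> cocolourable (induced G (set xs)) k}"
    by (simp add: reject_prob_def execute_induced_tester[OF G] vimage_def)
  show ?thesis
  proof (cases "?s > card (verts G)")
    \<comment> \<open>The whole graph is read, and the decision is exact.\<close>
    case True
    have "graph_dist G G = 0" by (simp add: graph_dist_def)
    then have "\<not> cocolourable G k"
      using far G \<epsilon> by (force simp: far_from_def cochromatic_at_most_iff)
    then show ?thesis
      using True fin by (simp add: rej sample_reply_def cocolourable_induced_verts[OF G])
  next
    case False
    then have ne: "verts G \<noteq> {}" using sample_size_bounds(1)[OF k \<epsilon>] by auto
    let ?A = "{xs. cocolourable (induced G (set xs)) k}"
    have "measure_pmf.prob (sample_reply G ?s) ?A \<le> 1 / 3"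
      using sampled_cocolourable_prob_le[OF G far ne k, of ?s] sample_size_sufficient[OF k \<epsilon> order_refl]
        False \<epsilon> by (simp add: sample_reply_def)
    moreover have "measure_pmf.prob (sample_reply G ?s) (- ?A) =
        1 - measure_pmf.prob (sample_reply G ?s) ?A"
      using measure_pmf.prob_compl[of ?A "sample_reply G ?s"] by (simp add: Compl_eq_Diff_UNIV)
    ultimately show ?thesis by (simp add: rej Collect_neg_eq)
  qed
qed

theorem corollary5p8:
  "\<exists>C>0. \<exists>c::nat. \<forall>k::nat\<ge>1. \<exists>T.
     size_oblivious_tester (cochromatic_at_most k) T \<and>
     one_sided (cochromatic_at_most k) T \<and>
     (\<forall>\<epsilon>::real>0. ereal_of_enat (query_complexity (T \<epsilon>))
        \<le> ereal (C * (real k ^ 7 / \<epsilon> ^ 6) * ln (2 + real k / \<epsilon>) ^ c))"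
proof (rule exI[of _ 625], intro conjI exI[of _ 2] allI impI)
  fix k :: nat assume k: "k \<ge> 1"
  define T where "T \<epsilon> = (if \<epsilon> < 1 then induced_tester (\<lambda>H. cocolourable H k) (sample_size k \<epsilon>)
    else Decide True)" for \<epsilon> :: real
  have Decide: "query_complexity (Decide True) = 0" "sample_complexity (Decide True) = 0"
    by (simp_all add: query_complexity_def sample_complexity_def zero_enat_def[symmetric]
        bot_enat_def[symmetric])
  have accept: "accept_prob (T \<epsilon>) G = 1"
    if "\<epsilon> > 0" "simple_graph G" "G \<in> cochromatic_at_most k" for \<epsilon> G
  proof (cases "\<epsilon> < 1")
    case True
    then show ?thesis
      using that sample_size_bounds(1)[OF k that(1)] unfolding T_def
      by (simp add: accept_prob_induced_tester cochromatic_at_most_iff cocolourable_induced)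
  qed (simp add: T_def accept_prob_def)
  have reject: "2 / 3 \<le> reject_prob (T \<epsilon>) G"
    if "\<epsilon> > 0" "simple_graph G" "far_from \<epsilon> (cochromatic_at_most k) G" for \<epsilon> G
  proof -
    have "\<epsilon> < 1" using that not_far_if_ge_1[OF that(2) k] by (meson not_le)
    then show ?thesis using induced_tester_rejects_far[OF that(2,3) k that(1)] by (simp add: T_def)
  qed
  have queries: "query_complexity (T \<epsilon>) \<le> enat (if \<epsilon> < 1 then (sample_size k \<epsilon>)\<^sup>2 else 0)"
    and labels: "sample_complexity (T \<epsilon>) \<le> enat (if \<epsilon> < 1 then sample_size k \<epsilon> else 0)"
    if "\<epsilon> > 0" for \<epsilon>
    using that Decide sample_size_bounds(1)[OF k that] unfolding T_def
    by (auto simp: query_complexity_induced_tester sample_complexity_induced_tester)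
  have finite: "query_complexity (T \<epsilon>) < \<infinity>" "sample_complexity (T \<epsilon>) < \<infinity>" if "\<epsilon> > 0" for \<epsilon>
    by (rule le_less_trans[OF queries[OF that]], simp, rule le_less_trans[OF labels[OF that]], simp)
  have bound: "ereal_of_enat (query_complexity (T \<epsilon>))
      \<le> ereal (625 * (real k ^ 7 / \<epsilon> ^ 6) * ln (2 + real k / \<epsilon>) ^ 2)" if "\<epsilon> > 0" for \<epsilon>
  proof -
    have "ereal_of_enat (query_complexity (T \<epsilon>)) \<le>
        ereal_of_enat (enat (if \<epsilon> < 1 then (sample_size k \<epsilon>)\<^sup>2 else 0))"
      using queries[OF that] by (simp only: ereal_of_enat_le_iff)
    also have "\<dots> \<le> ereal (625 * (real k ^ 7 / \<epsilon> ^ 6) * ln (2 + real k / \<epsilon>) ^ 2)"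
      using sample_size_bounds(2)[OF k that] that by simp
    finally show ?thesis .
  qed
  show "\<exists>T. size_oblivious_tester (cochromatic_at_most k) T \<and>
     one_sided (cochromatic_at_most k) T \<and>
     (\<forall>\<epsilon>::real>0. ereal_of_enat (query_complexity (T \<epsilon>))
        \<le> ereal (625 * (real k ^ 7 / \<epsilon> ^ 6) * ln (2 + real k / \<epsilon>) ^ 2))"
    using accept reject finite bound
    by (intro exI[of _ T]) (simp add: size_oblivious_tester_def one_sided_def)
qed simp

end
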